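(* Let $X$ be a real Hilbert space and let $\mathsf F:X\to X^\star$ satisfy (F1), (F2) and (F3). Assume that the forms $a(u;\cdot,\cdot)$, $u\in X$, are uniformly coercive and bounded with constants $\alpha,\beta>0$, let $\{u^n\}_{n\ge 0}\subset X$ be the sequence generated by $$\mathsf A[u^n]u^{n+1}=\mathsf A[u^n]u^n-\mathsf F(u^n),\qquad n\ge 0,$$ from an initial guess $u^0\in X$, and assume that this sequence satisfies (F4). Set $$C_1:=1+\frac{\beta}{\nu},\qquad C_2:=\frac{L_{\mathsf F}C_1^2}{2C_{\mathsf H}}.$$ Then for every $k\ge1$, $$\sum_{j=k+1}^\infty\|u^j-u^{j-1}\|_X^2\le C_2\|u^k-u^{k-1}\|_X^2 .$$ Moreover, for every $n\ge2$, $$\|u^n-u^{n-1}\|_X^2\le C_2\left(1+C_2^{-1}\right)^{2-n}\|u^1-u^0\|_X^2 .$$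
   Context: $X$ is a real Hilbert space with norm $\|\cdot\|_X$, dual $X^\star$ and duality pairing $\langle\cdot,\cdot\rangle$ on $X^\star\times X$. Conditions on $\mathsf F:X\to X^\star$: (F1) there is $L_{\mathsf F}>0$ with $|\langle \mathsf F(u)-\mathsf F(v),w\rangle|\le L_{\mathsf F}\|u-v\|_X\|w\|_X$ for all $u,v,w\in X$; (F2) there is $\nu>0$ with $\nu\|u-v\|_X^2\le\langle \mathsf F(u)-\mathsf F(v),u-v\rangle$ for all $u,v\in X$; (F3) there is a Gâteaux differentiable functional $\mathsf H:X\to\mathbb R$ with $\mathsf H'=\mathsf F$. For each $v\in X$, $\mathsf A[v]:X\to X^\star$ is a given linear invertible operator, and $a(u;v,w):=\langle \mathsf A[u]v,w\rangle$. Uniform coercivity and boundedness mean: there are $\alpha,\beta>0$, independent of $u\in X$, with $a(u;v,v)\ge\alpha\|v\|_X^2$ and $a(u;v,w)\le\beta\|v\|_X\|w\|_X$ for all $u,v,w\in X$. (F4) There is a constant $C_{\mathsf H}>0$ such that $\mathsf H(u^{n-1})-\mathsf H(u^n)\ge C_{\mathsf H}\|u^n-u^{n-1}\|_X^2$ for all $n\ge1$, where $\mathsf H$ is the potential from (F3). *)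

theory Defs
  imports "HOL-Analysis.Analysis"
begin

text \<open>
  A real Hilbert space is a type of sort {real_inner, complete_space}. Its dual is the type
  of bounded linear functionals, and the duality pairing of \<open>f\<close> and \<open>w\<close> is
  \<open>blinfun_apply f w\<close>.
\<close>

type_synonym 'a dual = "'a \<Rightarrow>\<^sub>L real"

definition lipschitz_operator :: "real \<Rightarrow> ('a::{real_inner,complete_space} \<Rightarrow> 'a dual) \<Rightarrow> bool" where
  "lipschitz_operator L F \<longleftrightarrow> L > 0 \<and>
     (\<forall>u v w. \<bar>blinfun_apply (F u - F v) w\<bar> \<le> L * norm (u - v) * norm w)"

definition strongly_monotone :: "real \<Rightarrow> ('a::{real_inner,complete_space} \<Rightarrow> 'a dual) \<Rightarrow> bool" where
  "strongly_monotone \<nu> F \<longleftrightarrow> \<nu> > 0 \<and>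
     (\<forall>u v. \<nu> * (norm (u - v))\<^sup>2 \<le> blinfun_apply (F u - F v) (u - v))"

definition has_gateaux_derivative ::
    "('a::{real_inner,complete_space} \<Rightarrow> real) \<Rightarrow> 'a dual \<Rightarrow> 'a \<Rightarrow> bool" where
  "has_gateaux_derivative H D u \<longleftrightarrow>
     (\<forall>v. ((\<lambda>t. (H (u + t *\<^sub>R v) - H u) / t) \<longlongrightarrow> blinfun_apply D v) (at (0::real)))"

definition potential_of ::
    "('a::{real_inner,complete_space} \<Rightarrow> real) \<Rightarrow> ('a \<Rightarrow> 'a dual) \<Rightarrow> bool" where
  "potential_of H F \<longleftrightarrow> (\<forall>u. has_gateaux_derivative H (F u) u)"

definition linear_invertible :: "('a::{real_inner,complete_space} \<Rightarrow> 'a dual) \<Rightarrow> bool" where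
  "linear_invertible B \<longleftrightarrow> linear B \<and> bij B"

definition induced_form ::
    "('a::{real_inner,complete_space} \<Rightarrow> 'a \<Rightarrow> 'a dual) \<Rightarrow> 'a \<Rightarrow> 'a \<Rightarrow> 'a \<Rightarrow> real" where
  "induced_form A u v w = blinfun_apply (A u v) w"

definition uniformly_coercive ::
    "real \<Rightarrow> ('a::{real_inner,complete_space} \<Rightarrow> 'a \<Rightarrow> 'a \<Rightarrow> real) \<Rightarrow> bool" where
  "uniformly_coercive \<alpha> a \<longleftrightarrow> \<alpha> > 0 \<and> (\<forall>u v. a u v v \<ge> \<alpha> * (norm v)\<^sup>2)"

definition uniformly_bounded ::
    "real \<Rightarrow> ('a::{real_inner,complete_space} \<Rightarrow> 'a \<Rightarrow> 'a \<Rightarrow> real) \<Rightarrow> bool" where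
  "uniformly_bounded \<beta> a \<longleftrightarrow> \<beta> > 0 \<and> (\<forall>u v w. a u v w \<le> \<beta> * norm v * norm w)"

definition iterates ::
    "('a::{real_inner,complete_space} \<Rightarrow> 'a \<Rightarrow> 'a dual) \<Rightarrow> ('a \<Rightarrow> 'a dual) \<Rightarrow> (nat \<Rightarrow> 'a) \<Rightarrow> bool" where
  "iterates A F u \<longleftrightarrow> (\<forall>n. A (u n) (u (n + 1)) = A (u n) (u n) - F (u n))"

definition energy_decay ::
    "real \<Rightarrow> ('a::{real_inner,complete_space} \<Rightarrow> real) \<Rightarrow> (nat \<Rightarrow> 'a) \<Rightarrow> bool" where
  "energy_decay C H u \<longleftrightarrow> C > 0 \<and>
     (\<forall>n\<ge>1. H (u (n - 1)) - H (u n) \<ge> C * (norm (u n - u (n - 1)))\<^sup>2)"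

end

(*
The energy decay (F4) telescopes to C_H * (a_(k+1) + ... + a_N) <= H(u^k) - H(u^N), where
a_j = ||u^j - u^(j-1)||^2. Strong monotonicity makes H bounded below, so the a_j are summable
and the residuals F(u^N), whose norms are at most beta * ||u^(N+1) - u^N||, tend to 0.
This allows u^N to play the role of the zero of F: by strong monotonicity,
||u^k - u^N|| <= C_1 * ||u^k - u^(k-1)|| + ||F(u^N)|| / nu, and expanding H around u^N gives
H(u^k) - H(u^N) <= L/2 * C_1^2 * a_k + o(1). Letting N tend to infinity yields the tail estimate,
and geometric decay follows since the tails T_k satisfy T_(k+1) <= C_2 * (T_k - T_(k+1)).
*)
theory Submission
  imports Defs
begin

text \<open>The difference quotient of H along the line is the Gateaux quotient at
  \<open>w + t *\<^sub>R d\<close> in direction \<open>d\<close>, so one-variable calculus becomes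
  available.\<close>

lemma potential_has_derivative_on_line:
  assumes "potential_of H F"
  shows "((\<lambda>t. H (w + t *\<^sub>R d)) has_real_derivative blinfun_apply (F (w + t *\<^sub>R d)) d) (at t)"
proof -
  have "((\<lambda>h. (H ((w + t *\<^sub>R d) + h *\<^sub>R d) - H (w + t *\<^sub>R d)) / h)
      \<longlongrightarrow> blinfun_apply (F (w + t *\<^sub>R d)) d) (at 0)"
    using assms by (simp add: potential_of_def has_gateaux_derivative_def)
  then show ?thesis
    by (simp add: DERIV_def algebra_simps)
qed

text \<open>Descent lemma: \<open>g\<close> is H on the segment from \<open>w\<close> to
  \<open>v\<close> minus the claimed quadratic majorant. By (F1) its derivative is nonpositive on
  [0,1].\<close>

lemma potential_upper_bound:
  assumes "potential_of H F" and "lipschitz_operator L F"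
  shows "H v - H w \<le> blinfun_apply (F w) (v - w) + L / 2 * (norm (v - w))\<^sup>2"
proof -
  define d where "d = v - w"
  define g where "g t = H (w + t *\<^sub>R d) - t * blinfun_apply (F w) d - L / 2 * t\<^sup>2 * (norm d)\<^sup>2" for t
  have "g 1 \<le> g 0"
  proof (rule DERIV_nonpos_imp_nonincreasing[where f = g])
    fix t :: real
    assume t: "0 \<le> t" "t \<le> 1"
    have "(g has_real_derivative
        blinfun_apply (F (w + t *\<^sub>R d)) d - blinfun_apply (F w) d - L * t * (norm d)\<^sup>2) (at t)"
      unfolding g_def
      by (intro DERIV_diff potential_has_derivative_on_line[OF assms(1)])
        (auto intro!: derivative_eq_intros)
    moreover have "\<bar>blinfun_apply (F (w + t *\<^sub>R d) - F w) d\<bar> \<le> L * norm (w + t *\<^sub>R d - w) * norm d"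
      using assms(2) unfolding lipschitz_operator_def by blast
    then have "blinfun_apply (F (w + t *\<^sub>R d)) d - blinfun_apply (F w) d - L * t * (norm d)\<^sup>2 \<le> 0"
      using t by (simp add: blinfun.diff_left power2_eq_square mult.assoc)
    ultimately show "\<exists>y. (g has_real_derivative y) (at t) \<and> y \<le> 0"
      by blast
  qed simp
  then show ?thesis
    by (simp add: g_def d_def)
qed

lemma potential_lower_bound:
  assumes "potential_of H F" and "strongly_monotone \<nu> F"
  shows "blinfun_apply (F w) (v - w) + \<nu> / 2 * (norm (v - w))\<^sup>2 \<le> H v - H w"
proof -
  define d where "d = v - w"
  define g where "g t = H (w + t *\<^sub>R d) - t * blinfun_apply (F w) d - \<nu> / 2 * t\<^sup>2 * (norm d)\<^sup>2" for t
  have "g 0 \<le> g 1"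
  proof (rule DERIV_nonneg_imp_nondecreasing[where f = g])
    fix t :: real
    assume t: "0 \<le> t" "t \<le> 1"
    have "(g has_real_derivative
        blinfun_apply (F (w + t *\<^sub>R d)) d - blinfun_apply (F w) d - \<nu> * t * (norm d)\<^sup>2) (at t)"
      unfolding g_def
      by (intro DERIV_diff potential_has_derivative_on_line[OF assms(1)])
        (auto intro!: derivative_eq_intros)
    \<comment> \<open>Strong monotonicity is applied to the increment \<open>t *\<^sub>R d\<close>,
      which yields the inequality multiplied by t. At t = 0, where t cannot be cancelled, the
      derivative is 0.\<close>
    moreover have "blinfun_apply (F (w + t *\<^sub>R d)) d - blinfun_apply (F w) d - \<nu> * t * (norm d)\<^sup>2 \<ge> 0"
    proof (cases "t = 0")
      case False
      have "\<nu> * (norm (w + t *\<^sub>R d - w))\<^sup>2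
          \<le> blinfun_apply (F (w + t *\<^sub>R d) - F w) (w + t *\<^sub>R d - w)"
        using assms(2) unfolding strongly_monotone_def by blast
      then have "t * (\<nu> * t * (norm d)\<^sup>2)
          \<le> t * (blinfun_apply (F (w + t *\<^sub>R d)) d - blinfun_apply (F w) d)"
        by (simp add: blinfun.diff_left blinfun.scaleR_right power_mult_distrib
            power2_eq_square algebra_simps)
      with False t show ?thesis
        by simp
    qed simp
    ultimately show "\<exists>y. (g has_real_derivative y) (at t) \<and> 0 \<le> y"
      by blast
  qed simp
  then show ?thesis
    by (simp add: g_def d_def)
qed

lemma potential_bounded_below:
  assumes "potential_of H F" and "strongly_monotone \<nu> F"
  shows "H w - (norm (F w))\<^sup>2 / (2 * \<nu>) \<le> H v"
proof -
  have \<nu>: "\<nu> > 0"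
    using assms(2) by (simp add: strongly_monotone_def)
  have "- (norm (F w) * norm (v - w)) \<le> blinfun_apply (F w) (v - w)"
    using norm_blinfun[of "F w" "v - w"] by simp
  \<comment> \<open>Completing the square minimises the quadratic lower bound over the distance s =
    \<open>norm (v - w)\<close>; the minimum is at s = \<open>norm (F w) / \<nu>\<close>.\<close>
  moreover have "0 \<le> (\<nu> * norm (v - w) - norm (F w))\<^sup>2 / (2 * \<nu>)"
    using \<nu> by simp
  then have "norm (F w) * norm (v - w) - \<nu> / 2 * (norm (v - w))\<^sup>2 \<le> (norm (F w))\<^sup>2 / (2 * \<nu>)"
    using \<nu> by (simp add: power2_eq_square field_simps)
  ultimately show ?thesis
    using potential_lower_bound[OF assms, of w v] by linarith
qed

lemma strongly_monotone_norm_le: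
  assumes "strongly_monotone \<nu> F"
  shows "\<nu> * norm (v - w) \<le> norm (F v - F w)"
proof (cases "v = w")
  case False
  have "\<nu> * (norm (v - w))\<^sup>2 \<le> blinfun_apply (F v - F w) (v - w)"
    using assms unfolding strongly_monotone_def by blast
  also have "\<dots> \<le> norm (F v - F w) * norm (v - w)"
    using norm_blinfun[of "F v - F w" "v - w"] by simp
  finally show ?thesis
    using False by (simp add: power2_eq_square)
qed simp

text \<open>The iteration rule says that F(u^n) is minus A[u^n] applied to the step, so the
  boundedness of the form bounds the dual norm.\<close>

lemma iterates_residual_bound:
  assumes "iterates A F u" and "linear (A (u n))" and "uniformly_bounded \<beta> (induced_form A)"
  shows "norm (F (u n)) \<le> \<beta> * norm (u (Suc n) - u n)"
proof (rule norm_blinfun_bound)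
  let ?d = "u (Suc n) - u n"
  show "0 \<le> \<beta> * norm ?d"
    using assms(3) by (simp add: uniformly_bounded_def)
  fix w
  have "A (u n) (u (Suc n)) = A (u n) (u n) - F (u n)"
    using assms(1) by (simp add: iterates_def)
  then have F: "F (u n) = - A (u n) ?d"
    using linear_diff[OF assms(2)] by simp
  have *: "blinfun_apply (A (u n) ?d) x \<le> \<beta> * norm ?d * norm x" for x
    using assms(3) by (simp add: uniformly_bounded_def induced_form_def)
  show "norm (blinfun_apply (F (u n)) w) \<le> \<beta> * norm ?d * norm w"
    \<comment> \<open>Boundedness is a one-sided inequality; testing with \<open>w\<close> and
      \<open>- w\<close> gives the absolute value.\<close>
    using *[of w] *[of "- w"] by (simp add: F blinfun.minus_left blinfun.minus_right abs_le_iff)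
qed

lemma energy_decay_sum:
  assumes "energy_decay C H u"
  shows "C * (\<Sum>j<n. (norm (u (Suc (j + k)) - u (j + k)))\<^sup>2) \<le> H (u k) - H (u (n + k))"
proof (induction n)
  case (Suc n)
  have "C * (norm (u (Suc (n + k)) - u (Suc (n + k) - 1)))\<^sup>2 \<le> H (u (Suc (n + k) - 1)) - H (u (Suc (n + k)))"
    using assms unfolding energy_decay_def by (metis le_add1 plus_1_eq_Suc)
  with Suc show ?case
    by (simp add: algebra_simps)
qed simp

lemma energy_decay_summable:
  assumes "energy_decay C H u" and "\<And>n. m \<le> H (u n)"
  shows "summable (\<lambda>j. (norm (u (Suc j) - u j))\<^sup>2)"
proof (rule summableI_nonneg_bounded)
  have C: "C > 0"
    using assms(1) by (simp add: energy_decay_def)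
  fix n
  have "C * (\<Sum>j<n. (norm (u (Suc j) - u j))\<^sup>2) \<le> H (u 0) - m"
    using energy_decay_sum[OF assms(1), of 0 n] assms(2)[of n] by simp
  then show "(\<Sum>j<n. (norm (u (Suc j) - u j))\<^sup>2) \<le> (H (u 0) - m) / C"
    using C by (simp add: field_simps)
qed simp

lemma geometric_decay_of_tail_bound:
  fixes a :: "nat \<Rightarrow> real"
  assumes "C > 0" and nonneg: "\<And>j. a j \<ge> 0" and "summable a"
    and tail: "\<And>k. (\<Sum>j. a (j + Suc k)) \<le> C * a k"
  shows "a (Suc n) \<le> C * inverse (1 + inverse C) ^ n * a 0"
proof -
  define T where "T k = (\<Sum>j. a (j + k))" for k
  have summable: "summable (\<lambda>j. a (j + k))" for k
    using assms(3) by (simp add: summable_iff_shift)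
  have split: "T k = a k + T (Suc k)" for k
    using suminf_split_head[OF summable[of k]] by (simp add: T_def)
  have T_nonneg: "T k \<ge> 0" for k
    unfolding T_def using summable nonneg by (intro suminf_nonneg)
  \<comment> \<open>Here \<open>a k\<close> is replaced by \<open>T k - T (Suc k)\<close> in the
    tail bound, and the inequality is solved for \<open>T (Suc k)\<close>.\<close>
  have "T (Suc k) \<le> inverse (1 + inverse C) * T k" for k
    using tail[of k] split[of k] \<open>C > 0\<close> by (simp add: T_def field_simps)
  then have "T (Suc n) \<le> inverse (1 + inverse C) ^ n * T 1"
  proof (induction n)
    case (Suc n)
    have "T (Suc (Suc n)) \<le> inverse (1 + inverse C) * T (Suc n)"
      by (rule Suc.prems)
    also have "\<dots> \<le> inverse (1 + inverse C) * (inverse (1 + inverse C) ^ n * T 1)"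
      using Suc \<open>C > 0\<close> by (intro mult_left_mono) auto
    finally show ?case
      by simp
  qed simp
  \<comment> \<open>The prefactor C comes from the tail bound at index 0; a single term
    \<open>a (Suc n)\<close> is then at most the tail it starts.\<close>
  also have "\<dots> \<le> inverse (1 + inverse C) ^ n * (C * a 0)"
    using tail[of 0] \<open>C > 0\<close> by (intro mult_left_mono) (auto simp: T_def)
  finally show ?thesis
    using split[of "Suc n"] T_nonneg[of "Suc (Suc n)"] by (simp add: mult_ac)
qed

lemma tail_bound:
  assumes F1: "lipschitz_operator L F" and F2: "strongly_monotone \<nu> F" and F3: "potential_of H F"
    and lin: "\<And>v. linear (A v)" and bounded: "uniformly_bounded \<beta> (induced_form A)"
    and iter: "iterates A F u" and F4: "energy_decay C H u"
    and summable: "summable (\<lambda>j. (norm (u (Suc j) - u j))\<^sup>2)"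
  shows "(\<Sum>j. (norm (u (Suc (j + Suc k)) - u (j + Suc k)))\<^sup>2)
    \<le> L * (1 + \<beta> / \<nu>)\<^sup>2 / (2 * C) * (norm (u (Suc k) - u k))\<^sup>2"
proof -
  have pos: "L > 0" "\<nu> > 0" "\<beta> > 0" "C > 0"
    using F1 F2 bounded F4
    by (auto simp: lipschitz_operator_def strongly_monotone_def uniformly_bounded_def energy_decay_def)
  define d where "d = norm (u (Suc k) - u k)"
  \<comment> \<open>The shift by \<open>Suc k\<close> makes \<open>e n\<close> the residual at the
    endpoint of the telescoped sum \<open>S n\<close>.\<close>
  define e where "e n = norm (F (u (n + Suc k)))" for n
  define S where "S n = (\<Sum>j<n. (norm (u (Suc (j + Suc k)) - u (j + Suc k)))\<^sup>2)" for n
  have residual: "norm (F (u n)) \<le> \<beta> * norm (u (Suc n) - u n)" for n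
    using iterates_residual_bound[OF iter lin bounded] .
  have "(\<lambda>n. sqrt ((norm (u (Suc n) - u n))\<^sup>2)) \<longlonglongrightarrow> sqrt 0"
    by (intro tendsto_real_sqrt summable_LIMSEQ_zero[OF summable])
  then have "(\<lambda>n. \<beta> * norm (u (Suc n) - u n)) \<longlonglongrightarrow> \<beta> * 0"
    by (intro tendsto_mult_left) simp
  then have "(\<lambda>n. norm (F (u n))) \<longlonglongrightarrow> 0"
    using Lim_null_comparison[of "\<lambda>n. norm (F (u n))" "\<lambda>n. \<beta> * norm (u (Suc n) - u n)"] residual
    by simp
  then have e: "e \<longlonglongrightarrow> 0"
    unfolding e_def by (rule LIMSEQ_ignore_initial_segment)
  have bound: "C * S n \<le> e n * ((1 + \<beta> / \<nu>) * d + e n / \<nu>) + L / 2 * ((1 + \<beta> / \<nu>) * d + e n / \<nu>)\<^sup>2" for n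
  proof -
    let ?N = "n + Suc k"
    define r where "r = norm (u (Suc k) - u ?N)"
    \<comment> \<open>The distance is measured from \<open>u k\<close>, not
      \<open>u (Suc k)\<close>, because the residual at \<open>u k\<close> is controlled by the step
      \<open>d\<close>. Returning to \<open>u (Suc k)\<close> costs one more \<open>d\<close>, which
      is the summand 1 in C_1.\<close>
    have "\<nu> * norm (u k - u ?N) \<le> norm (F (u k)) + norm (F (u ?N))"
      using strongly_monotone_norm_le[OF F2] norm_triangle_ineq4 order_trans by blast
    also have "\<dots> \<le> \<beta> * d + e n"
      using residual[of k] by (simp add: d_def e_def)
    finally have "norm (u k - u ?N) \<le> \<beta> / \<nu> * d + e n / \<nu>"
      using pos by (simp add: field_simps)
    moreover have "r \<le> d + norm (u k - u ?N)"
      unfolding r_def d_def using norm_triangle_ineq[of "u (Suc k) - u k" "u k - u ?N"] by simp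
    ultimately have r: "r \<le> (1 + \<beta> / \<nu>) * d + e n / \<nu>"
      by (simp add: algebra_simps)
    have "C * S n \<le> H (u (Suc k)) - H (u ?N)"
      unfolding S_def by (rule energy_decay_sum[OF F4])
    also have "\<dots> \<le> blinfun_apply (F (u ?N)) (u (Suc k) - u ?N) + L / 2 * r\<^sup>2"
      unfolding r_def by (rule potential_upper_bound[OF F3 F1])
    also have "\<dots> \<le> e n * r + L / 2 * r\<^sup>2"
      using norm_blinfun[of "F (u ?N)" "u (Suc k) - u ?N"] by (simp add: e_def r_def)
    also have "\<dots> \<le> e n * ((1 + \<beta> / \<nu>) * d + e n / \<nu>) + L / 2 * ((1 + \<beta> / \<nu>) * d + e n / \<nu>)\<^sup>2"
      using r pos by (intro add_mono mult_left_mono power_mono) (auto simp: e_def r_def)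
    finally show ?thesis .
  qed
  have "summable (\<lambda>j. (norm (u (Suc (j + Suc k)) - u (j + Suc k)))\<^sup>2)"
    using summable_ignore_initial_segment[OF summable] .
  then have "S \<longlonglongrightarrow> (\<Sum>j. (norm (u (Suc (j + Suc k)) - u (j + Suc k)))\<^sup>2)"
    unfolding S_def by (rule summable_LIMSEQ)
  then have "(\<lambda>n. C * S n) \<longlonglongrightarrow> C * (\<Sum>j. (norm (u (Suc (j + Suc k)) - u (j + Suc k)))\<^sup>2)"
    by (rule tendsto_mult_left)
  \<comment> \<open>As the residuals vanish, only L/2 times the square of C_1 d survives; division
    by C turns this into C_2 times the squared step.\<close>
  moreover have "(\<lambda>n. e n * ((1 + \<beta> / \<nu>) * d + e n / \<nu>) + L / 2 * ((1 + \<beta> / \<nu>) * d + e n / \<nu>)\<^sup>2)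
      \<longlonglongrightarrow> 0 * ((1 + \<beta> / \<nu>) * d + 0 / \<nu>) + L / 2 * ((1 + \<beta> / \<nu>) * d + 0 / \<nu>)\<^sup>2"
    using pos by (intro tendsto_intros e) auto
  ultimately have "C * (\<Sum>j. (norm (u (Suc (j + Suc k)) - u (j + Suc k)))\<^sup>2)
      \<le> 0 * ((1 + \<beta> / \<nu>) * d + 0 / \<nu>) + L / 2 * ((1 + \<beta> / \<nu>) * d + 0 / \<nu>)\<^sup>2"
    using bound by (intro LIMSEQ_le) auto
  then have "(\<Sum>j. (norm (u (Suc (j + Suc k)) - u (j + Suc k)))\<^sup>2) * C
      \<le> L / 2 * ((1 + \<beta> / \<nu>)\<^sup>2 * d\<^sup>2)"
    by (simp add: power_mult_distrib mult.commute)
  then have "(\<Sum>j. (norm (u (Suc (j + Suc k)) - u (j + Suc k)))\<^sup>2)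
      \<le> L / 2 * ((1 + \<beta> / \<nu>)\<^sup>2 * d\<^sup>2) / C"
    using pos by (simp only: pos_le_divide_eq)
  then show ?thesis
    by (simp add: d_def mult_ac)
qed

text \<open>Links ordered series to the unordered sums of the final statement: nonnegative terms
  make a convergent series unordered summable, and shifting by k is a bijection onto
  \<open>{k..}\<close>.\<close>

lemma has_sum_atLeast_suminf:
  fixes f :: "nat \<Rightarrow> real"
  assumes "summable (\<lambda>j. f (j + k))" and "\<And>j. f j \<ge> 0"
  shows "(f has_sum (\<Sum>j. f (j + k))) {k..}"
proof -
  have "((f \<circ> (\<lambda>j. j + k)) has_sum (\<Sum>j. f (j + k))) UNIV"
    unfolding o_def using assms by (intro sums_nonneg_imp_has_sum summable_sums) auto
  moreover have "range (\<lambda>j. j + k) = {k..}"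
    by (auto simp: image_iff) (metis le_add_diff_inverse2)
  ultimately show ?thesis
    using has_sum_reindex[of "\<lambda>j. j + k" UNIV f] by (simp add: inj_on_def)
qed

theorem proposition2p4:
  fixes F :: "'a::{real_inner,complete_space} \<Rightarrow> 'a dual"
    and H :: "'a \<Rightarrow> real"
    and A :: "'a \<Rightarrow> 'a \<Rightarrow> 'a dual"
    and u :: "nat \<Rightarrow> 'a"
    and L \<nu> \<alpha> \<beta> C\<^sub>H C\<^sub>1 C\<^sub>2 :: real
  assumes F1: "lipschitz_operator L F"
    and F2: "strongly_monotone \<nu> F"
    and F3: "potential_of H F"
    and A_inv: "\<And>v. linear_invertible (A v)"
    and coercive: "uniformly_coercive \<alpha> (induced_form A)"
    and bounded: "uniformly_bounded \<beta> (induced_form A)"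
    and iter: "iterates A F u"
    and F4: "energy_decay C\<^sub>H H u"
    and C1: "C\<^sub>1 = 1 + \<beta> / \<nu>"
    and C2: "C\<^sub>2 = L * C\<^sub>1\<^sup>2 / (2 * C\<^sub>H)"
  shows "(\<forall>k\<ge>1. (\<lambda>j. (norm (u j - u (j - 1)))\<^sup>2) summable_on {k+1..} \<and>
            (\<Sum>\<^sub>\<infinity>j\<in>{k+1..}. (norm (u j - u (j - 1)))\<^sup>2) \<le> C\<^sub>2 * (norm (u k - u (k - 1)))\<^sup>2) \<and>
         (\<forall>n\<ge>2. (norm (u n - u (n - 1)))\<^sup>2
            \<le> C\<^sub>2 * (1 + inverse C\<^sub>2) powi (2 - int n) * (norm (u 1 - u 0))\<^sup>2)"
proof (intro conjI allI impI)
  have pos: "L > 0" "\<nu> > 0" "\<beta> > 0" "C\<^sub>H > 0"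
    using F1 F2 bounded F4
    by (auto simp: lipschitz_operator_def strongly_monotone_def uniformly_bounded_def energy_decay_def)
  then have "C\<^sub>2 > 0"
    unfolding C1 C2 by (intro divide_pos_pos mult_pos_pos zero_less_power add_pos_pos) auto
  have lin: "linear (A v)" for v
    using A_inv by (simp add: linear_invertible_def)
  \<comment> \<open>Counting steps from 0 avoids truncated subtraction: \<open>a j\<close> belongs
    to the step numbered j + 1.\<close>
  define a where "a j = (norm (u (Suc j) - u j))\<^sup>2" for j
  have summable: "summable a"
    unfolding a_def by (rule energy_decay_summable[OF F4 potential_bounded_below[OF F3 F2]])
  have tail: "(\<Sum>j. a (j + Suc k)) \<le> C\<^sub>2 * a k" for k
    using tail_bound[OF F1 F2 F3 lin bounded iter F4, of k] summable
    unfolding a_def C1 C2 by blast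
  {
    fix k :: nat
    assume "k \<ge> 1"
    then obtain m where m: "k = Suc m"
      by (cases k) auto
    \<comment> \<open>The summand with index j + k + 1 is \<open>a (j + k)\<close>, so with k =
      \<open>Suc m\<close> this is the tail bounded by \<open>tail[of m]\<close>.\<close>
    have "((\<lambda>j. (norm (u j - u (j - 1)))\<^sup>2) has_sum (\<Sum>j. a (j + k))) {k + 1..}"
      using has_sum_atLeast_suminf[of "\<lambda>j. (norm (u j - u (j - 1)))\<^sup>2" "k + 1"]
        summable_ignore_initial_segment[OF summable, of k]
      by (simp add: a_def)
    then show "(\<lambda>j. (norm (u j - u (j - 1)))\<^sup>2) summable_on {k + 1..}"
      and "(\<Sum>\<^sub>\<infinity>j\<in>{k + 1..}. (norm (u j - u (j - 1)))\<^sup>2) \<le> C\<^sub>2 * (norm (u k - u (k - 1)))\<^sup>2"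
      using tail[of m] by (auto simp: m a_def has_sum_imp_summable infsumI)
  }
  fix n :: nat
  assume "n \<ge> 2"
  then obtain m where m: "n = Suc (Suc m)"
    by (metis add_2_eq_Suc le_Suc_ex)
  have "a (Suc m) \<le> C\<^sub>2 * inverse (1 + inverse C\<^sub>2) ^ m * a 0"
    by (rule geometric_decay_of_tail_bound[OF \<open>C\<^sub>2 > 0\<close> _ summable tail]) (simp add: a_def)
  \<comment> \<open>Since m = n - 2, the integer exponent is -m.\<close>
  moreover have "(1 + inverse C\<^sub>2) powi (2 - int n) = inverse (1 + inverse C\<^sub>2) ^ m"
    by (simp add: m power_int_minus power_inverse)
  ultimately show "(norm (u n - u (n - 1)))\<^sup>2
      \<le> C\<^sub>2 * (1 + inverse C\<^sub>2) powi (2 - int n) * (norm (u 1 - u 0))\<^sup>2"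
    by (simp add: m a_def)
qed

end
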